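(* There are infinitely many Laurent polynomials of the form $f(x)=x+b+\frac{c}{x}+\frac{d}{x^2}$ with nonzero integers $b,c,d$ such that the Diophantine equation $z^2=f(x)^2+f(y)^2$ or the Diophantine equation $z^2=f(x)^2-f(y)^2$ has infinitely many nontrivial rational solutions.
   Context: A Laurent polynomial with coefficients in a field is an expression $\sum_k a_kx^k$ in a formal variable $x$, where $k$ runs over integers (not necessarily positive) and only finitely many coefficients $a_k$ are nonzero. A rational solution of one of the equations $z^2=f(x)^2\pm f(y)^2$ is a triple $(x,y,z)\in\mathbb{Q}^3$ with $x\neq 0$ and $y\neq 0$ (so that $f(x),f(y)$ are defined) satisfying the equation. A solution $(x,y,z)$ of $z^2=f(x)^2+f(y)^2$ is called nontrivial if $f(x)f(y)\neq 0$; a solution $(x,y,z)$ of $z^2=f(x)^2-f(y)^2$ is called nontrivial if $f(x)^2\neq f(y)^2$. *)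

theory Defs
  imports Complex_Main "HOL-Library.Poly_Mapping"
begin

text \<open>
  A Laurent polynomial over a field is a finitely supported family of coefficients indexed by the
  integers; \<open>Poly_Mapping.single k a\<close> is the monomial \<open>a x\<^sup>k\<close>.
\<close>

type_synonym 'a laurent_poly = "int \<Rightarrow>\<^sub>0 'a"

text \<open>Only meaningful for \<open>x \<noteq> 0\<close>, since negative powers of zero are zero by convention.\<close>

definition laurent_eval :: "'a::field laurent_poly \<Rightarrow> 'a \<Rightarrow> 'a" where
  "laurent_eval f x = (\<Sum>k\<in>Poly_Mapping.keys f. Poly_Mapping.lookup f k * x powi k)"

definition nontrivial_sum_solutions :: "rat laurent_poly \<Rightarrow> (rat \<times> rat \<times> rat) set" where
  "nontrivial_sum_solutions f = {(x, y, z). x \<noteq> 0 \<and> y \<noteq> 0 \<and>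
     z\<^sup>2 = (laurent_eval f x)\<^sup>2 + (laurent_eval f y)\<^sup>2 \<and>
     laurent_eval f x * laurent_eval f y \<noteq> 0}"

definition nontrivial_diff_solutions :: "rat laurent_poly \<Rightarrow> (rat \<times> rat \<times> rat) set" where
  "nontrivial_diff_solutions f = {(x, y, z). x \<noteq> 0 \<and> y \<noteq> 0 \<and>
     z\<^sup>2 = (laurent_eval f x)\<^sup>2 - (laurent_eval f y)\<^sup>2 \<and>
     (laurent_eval f x)\<^sup>2 \<noteq> (laurent_eval f y)\<^sup>2}"

definition laurent_of_ints :: "int \<Rightarrow> int \<Rightarrow> int \<Rightarrow> rat laurent_poly" where
  "laurent_of_ints b c d =
     Poly_Mapping.single 1 1 + Poly_Mapping.single 0 (of_int b) +
     Poly_Mapping.single (-1) (of_int c) + Poly_Mapping.single (-2) (of_int d)"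

lemma laurent_eval_superset:
  assumes "finite A" "Poly_Mapping.keys f \<subseteq> A"
  shows "laurent_eval f x = (\<Sum>k\<in>A. Poly_Mapping.lookup f k * x powi k)"
  unfolding laurent_eval_def
  using assms by (intro sum.mono_neutral_left) (auto simp: in_keys_iff)

lemma laurent_eval_add: "laurent_eval (f + g) x = laurent_eval f x + laurent_eval g x"
proof -
  let ?A = "Poly_Mapping.keys f \<union> Poly_Mapping.keys g"
  have "Poly_Mapping.keys (f + g) \<subseteq> ?A"
    by (rule Poly_Mapping.keys_add)
  then show ?thesis
    by (simp add: laurent_eval_superset[of ?A] lookup_add distrib_right sum.distrib)
qed

lemma laurent_eval_single: "laurent_eval (Poly_Mapping.single k a) x = a * x powi k"
  by (simp add: laurent_eval_def)

lemma laurent_eval_laurent_of_ints: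
  "laurent_eval (laurent_of_ints b c d) x = x + of_int b + of_int c / x + of_int d / x\<^sup>2"
  unfolding laurent_of_ints_def laurent_eval_add laurent_eval_single
  by (simp add: power_int_minus divide_inverse)

end

theory Submission imports Defs begin

text \<open>
  For \<open>f(x) = (x + t)\<^sup>3 / x\<^sup>2\<close>, the equation \<open>f(x) = m f(y)\<close> reads \<open>v\<^sup>3 = m u\<^sup>2\<close> in terms of
  \<open>u = x / y\<close> and \<open>v = (x + t) / (y + t)\<close>. This cuspidal cubic is parametrised by \<open>u = m s\<^sup>3\<close>,
  \<open>v = m s\<^sup>2\<close>, and \<open>x\<close>, \<open>y\<close> are recovered rationally from \<open>u\<close>, \<open>v\<close>. For \<open>m = 3/4\<close> the sum
  \<open>f(x)\<^sup>2 + f(y)\<^sup>2 = (5/4 f(y))\<^sup>2\<close> is a square.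
\<close>

text \<open>The coefficients come from expanding \<open>(x + t) ^ 3\<close> and dividing by
  \<open>x\<^sup>2\<close>.\<close>

lemma laurent_eval_cube:
  assumes "x \<noteq> 0"
  shows "laurent_eval (laurent_of_ints (3 * t) (3 * t\<^sup>2) (t ^ 3)) x = (x + of_int t) ^ 3 / x\<^sup>2"
  using assms
  by (simp add: laurent_eval_laurent_of_ints field_simps power2_eq_square power3_eq_cube)

lemma infinite_nontrivial_sum_solutions_cube:
  fixes t :: int
  assumes "t > 0"
  shows "infinite (nontrivial_sum_solutions (laurent_of_ints (3 * t) (3 * t\<^sup>2) (t ^ 3)))"
    (is "infinite (nontrivial_sum_solutions ?f)")
proof -
  define T :: rat where "T = of_int t"
  \<comment> \<open>The offset 2 ensures \<open>s n > 1\<close> and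
    \<open>3 * (s n)\<^sup>2 > 4\<close>, which makes \<open>y n\<close> positive.\<close>
  define s :: "nat \<Rightarrow> rat" where "s n = of_nat n + 2" for n
  \<comment> \<open>With \<open>u = 3/4 s^3\<close> and \<open>v = 3/4 s^2\<close>, the linear
    equation \<open>u y + T = v (y + T)\<close> has the solution
    \<open>y = T (v - 1) / (u - v)\<close>.\<close>
  define y where "y n = T * (3 * (s n)\<^sup>2 - 4) / (3 * (s n)\<^sup>2 * (s n - 1))" for n
  define x where "x n = 3 / 4 * s n ^ 3 * y n" for n
  define z where "z n = 5 / 4 * laurent_eval ?f (y n)" for n
  have T: "T > 0" using assms by (simp add: T_def)
  have s: "s n \<ge> 2" for n by (simp add: s_def)
  have s2: "(s n)\<^sup>2 \<ge> 4" for n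
    using power_mono[OF s, of 2 n] by simp
  have y: "y n > 0" for n
  proof -
    have "3 * (s n)\<^sup>2 - 4 > 0" "3 * (s n)\<^sup>2 > 0" "s n - 1 > 0"
      using s2[of n] s[of n] by linarith+
    then show ?thesis unfolding y_def using T by simp
  qed
  have x: "x n > 0" for n
    using y[of n] s[of n] by (simp add: x_def)
  have shift: "x n + T = 3 / 4 * (s n)\<^sup>2 * (y n + T)" for n
  proof -
    have "s n \<noteq> 0" "s n - 1 \<noteq> 0" using s[of n] by auto
    then have "y n * (3 * (s n)\<^sup>2 * (s n - 1)) = T * (3 * (s n)\<^sup>2 - 4)"
      by (simp add: y_def)
    then show ?thesis
      by (simp add: x_def algebra_simps power2_eq_square power3_eq_cube)
  qed
  have fx: "laurent_eval ?f (x n) = 3 / 4 * laurent_eval ?f (y n)" for n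
  proof -
    have "s n \<noteq> 0" "x n \<noteq> 0" "y n \<noteq> 0" using s[of n] x[of n] y[of n] by auto
    then have "laurent_eval ?f (x n) = (x n + T) ^ 3 / (x n)\<^sup>2"
      by (simp add: laurent_eval_cube T_def)
    also have "\<dots> = (3 / 4 * (s n)\<^sup>2 * (y n + T)) ^ 3 / (3 / 4 * s n ^ 3 * y n)\<^sup>2"
      by (simp only: shift) (simp only: x_def)
    \<comment> \<open>The factors \<open>s n ^ 6\<close> cancel, and
      \<open>(3/4)^3 / (3/4)^2\<close> leaves \<open>3/4\<close>.\<close>
    also have "\<dots> = 3 / 4 * ((y n + T) ^ 3 / (y n)\<^sup>2)"
      using \<open>s n \<noteq> 0\<close> \<open>y n \<noteq> 0\<close> by (simp add: power_mult_distrib power_divide flip: power_mult)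
    finally show ?thesis using \<open>y n \<noteq> 0\<close> by (simp add: laurent_eval_cube T_def)
  qed
  have fy: "laurent_eval ?f (y n) > 0" for n
    using y[of n] assms by (simp add: laurent_eval_cube)
  have "(x n, y n, z n) \<in> nontrivial_sum_solutions ?f" for n
    using x[of n] y[of n] fy[of n]
    by (simp add: nontrivial_sum_solutions_def fx z_def power_mult_distrib power_divide)
  then have "range (\<lambda>n. (x n, y n, z n)) \<subseteq> nontrivial_sum_solutions ?f" by blast
  moreover have "inj (\<lambda>n. (x n, y n, z n))"
  proof (rule injI)
    fix m n assume eq: "(x m, y m, z m) = (x n, y n, z n)"
    \<comment> \<open>The ratio \<open>x / y = 3/4 s^3\<close> recovers the parameter from the
      solution.\<close>
    then have "s m ^ 3 = s n ^ 3" using y[of n] by (auto simp: x_def)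
    then have "s m = s n"
      by (rule power_eq_imp_eq_base) (use s[of m] s[of n] in auto)
    then show "m = n" by (simp add: s_def)
  qed
  ultimately show ?thesis
    unfolding infinite_iff_countable_subset by blast
qed

theorem corollary1p3:
  "infinite {f :: rat laurent_poly.
     (\<exists>b c d :: int. b \<noteq> 0 \<and> c \<noteq> 0 \<and> d \<noteq> 0 \<and> f = laurent_of_ints b c d) \<and>
     (infinite (nontrivial_sum_solutions f) \<or> infinite (nontrivial_diff_solutions f))}"
  (is "infinite ?S")
proof -
  define F where "F n = (let t = int n + 1 in laurent_of_ints (3 * t) (3 * t\<^sup>2) (t ^ 3))" for n
  have "F n \<in> ?S" for n
  proof -
    define t where "t = int n + 1"
    have "t > 0" by (simp add: t_def)
    moreover have "F n = laurent_of_ints (3 * t) (3 * t\<^sup>2) (t ^ 3)"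
      by (simp add: F_def t_def Let_def)
    moreover have "3 * t \<noteq> 0" "3 * t\<^sup>2 \<noteq> 0" "t ^ 3 \<noteq> 0"
      using \<open>t > 0\<close> by auto
    ultimately show ?thesis
      using infinite_nontrivial_sum_solutions_cube[of t] by (metis (mono_tags, lifting) mem_Collect_eq)
  qed
  then have "range F \<subseteq> ?S" by blast
  moreover have "inj F"
  proof (rule injI)
    fix m n assume "F m = F n"
    \<comment> \<open>The constant coefficient \<open>3 * t\<close> already determines
      \<open>t\<close>.\<close>
    then have "Poly_Mapping.lookup (F m) 0 = Poly_Mapping.lookup (F n) 0" by simp
    then show "m = n"
      by (simp add: F_def Let_def laurent_of_ints_def lookup_add lookup_single)
  qed
  ultimately show ?thesis
    unfolding infinite_iff_countable_subset by blast
qed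

end
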